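(* Let $\beta$ be a basis set in the variables $x_1,x_2,x_3$, and for each pair $(i,j)\in\{(1,2),(1,3),(2,3)\}$ let $G(i,j)$ be the set of minimal generators of $I_\beta$ that involve only variables in $\{x_i,x_j\}$. If $|G(i,j)|>2$ for all three pairs $(i,j)$, then there exists a non-standard arrow for $\beta$ that is not translation-equivalent to $0$; consequently $\beta$ is not smooth.
   Context: $k$ is an algebraically closed field; monomials are identified with exponent vectors. A basis set is a finite nonempty set $\beta$ of monomials closed under taking divisors; $I_\beta$ is the ideal generated by monomials not in $\beta$; $\beta$ is smooth if the point corresponding to $I_\beta$ is a nonsingular point of the Hilbert scheme of $|\beta|$ points of $\mathbb A^3_k$. An arrow is a pair $(\mathbf d,\mathbf j)$ with tail $\mathbf x^{\mathbf d}\notin\beta$ and head $\mathbf x^{\mathbf j}\in\beta$; it is standard if the vector $\mathbf j-\mathbf d$ has exactly one negative component, non-standard otherwise. A translation step replaces $(\mathbf d,\mathbf j)$ by $(\mathbf d\pm e_i,\mathbf j\pm e_i)$ provided the result is again an arrow; $\sim$ is the generated equivalence relation. An arrow $c$ is translation-equivalent to $0$ if $c\sim(\mathbf d',\mathbf j')$ with, for some $i$, $j'_i=0$, $d'_i\ge1$ and $\mathbf x^{\mathbf d'-e_i}\notin\beta$. *)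

theory Defs
  imports "HOL-Library.Numeral_Type"
begin

text \<open>Monomials in x1,x2,x3 are identified with exponent vectors, i.e. functions
  from the three-element index type 3 to nat. Divisibility is the pointwise order.\<close>
type_synonym mon = "3 \<Rightarrow> nat"

definition basis_set :: "mon set \<Rightarrow> bool" where
  "basis_set \<beta> \<longleftrightarrow> finite \<beta> \<and> \<beta> \<noteq> {} \<and> (\<forall>m\<in>\<beta>. \<forall>m'. m' \<le> m \<longrightarrow> m' \<in> \<beta>)"

text \<open>Minimal generators of the monomial ideal I_beta generated by the monomials
  not in beta: the divisibility-minimal monomials outside beta.\<close>
definition min_gens :: "mon set \<Rightarrow> mon set" where
  "min_gens \<beta> = {m. m \<notin> \<beta> \<and> (\<forall>m'. m' \<le> m \<and> m' \<noteq> m \<longrightarrow> m' \<in> \<beta>)}"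

definition G :: "mon set \<Rightarrow> 3 \<Rightarrow> 3 \<Rightarrow> mon set" where
  "G \<beta> i j = {m \<in> min_gens \<beta>. \<forall>k. k \<noteq> i \<and> k \<noteq> j \<longrightarrow> m k = 0}"

type_synonym arrow = "mon \<times> mon"

definition is_arrow :: "mon set \<Rightarrow> arrow \<Rightarrow> bool" where
  "is_arrow \<beta> c \<longleftrightarrow> fst c \<notin> \<beta> \<and> snd c \<in> \<beta>"

definition standard_arrow :: "arrow \<Rightarrow> bool" where
  "standard_arrow c \<longleftrightarrow> card {i. snd c i < fst c i} = 1"

definition translation_step :: "mon set \<Rightarrow> arrow \<Rightarrow> arrow \<Rightarrow> bool" where
  "translation_step \<beta> c c' \<longleftrightarrow> is_arrow \<beta> c \<and> is_arrow \<beta> c' \<and>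
     (\<exists>i. c' = ((fst c)(i := fst c i + 1), (snd c)(i := snd c i + 1))
        \<or> (fst c i \<ge> 1 \<and> snd c i \<ge> 1 \<and>
           c' = ((fst c)(i := fst c i - 1), (snd c)(i := snd c i - 1))))"

definition translation_equiv :: "mon set \<Rightarrow> arrow \<Rightarrow> arrow \<Rightarrow> bool" where
  "translation_equiv \<beta> = (\<lambda>c c'. translation_step \<beta> c c' \<or> translation_step \<beta> c' c)\<^sup>*\<^sup>*"

definition trans_equiv_zero :: "mon set \<Rightarrow> arrow \<Rightarrow> bool" where
  "trans_equiv_zero \<beta> c \<longleftrightarrow> (\<exists>d' j'. translation_equiv \<beta> c (d', j') \<and>
     (\<exists>i. j' i = 0 \<and> d' i \<ge> 1 \<and> d'(i := d' i - 1) \<notin> \<beta>))"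

end

theory Submission
  imports Defs "HOL-Library.Product_Order"
begin

text \<open>
  Let \<open>C\<close> be the largest exponent with \<open>x\<^sub>3\<^sup>C \<in> \<beta>\<close>, and regard the bottom and top slices
  \<open>E = {(a, b). x\<^sub>1\<^sup>a x\<^sub>2\<^sup>b \<in> \<beta>}\<close> and \<open>D = {(a, b). x\<^sub>1\<^sup>a x\<^sub>2\<^sup>b x\<^sub>3\<^sup>C \<in> \<beta>}\<close> as down-closed
  subsets of \<open>\<nat>\<^sup>2\<close>. Since each \<open>G(i,j)\<close> has more than two elements, it contains a generator
  involving both of its variables. The one in \<open>G(1,2)\<close> is an outer corner of \<open>E\<close>; the ones in
  \<open>G(1,3)\<close> and \<open>G(2,3)\<close> make \<open>D\<close> strictly shorter than \<open>E\<close> along both axes.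

  From this one finds \<open>k \<in> \<nat>\<^sup>2\<close> and a shift \<open>s \<ge> (1, 1)\<close> such that the arrows from
  \<open>x\<^sup>p\<^sup>+\<^sup>s\<close> to \<open>x\<^sup>p x\<^sub>3\<^sup>C\<close>, for \<open>p \<in> D\<close> with \<open>p \<ge> k\<close> and \<open>p + s \<notin> E\<close>, form a nonempty set closed
  under translation: raising \<open>x\<^sub>3\<close> moves the head out of \<open>\<beta>\<close>, lowering \<open>x\<^sub>3\<close> is impossible, and
  crossing one of the walls \<open>p\<^sub>1 = k\<^sub>1\<close>, \<open>p\<^sub>2 = k\<^sub>2\<close> moves the tail into \<open>\<beta>\<close>. None of these arrows
  has the shape required by translation-equivalence to \<open>0\<close>, and each has two negative components.
\<close>

section \<open>Down-closed sets of the plane and their outer corners\<close>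

type_synonym point = "nat \<times> nat"

definition down_closed :: "'a::order set \<Rightarrow> bool" where
  "down_closed S \<longleftrightarrow> (\<forall>p\<in>S. \<forall>q\<le>p. q \<in> S)"

lemma down_closedD: "down_closed S \<Longrightarrow> p \<in> S \<Longrightarrow> q \<le> p \<Longrightarrow> q \<in> S"
  unfolding down_closed_def by blast

definition outer_corners :: "'a::order set \<Rightarrow> 'a set" where
  "outer_corners S = {p. p \<notin> S \<and> (\<forall>q<p. q \<in> S)}"

lemma outer_cornersD:
  assumes "p \<in> outer_corners S"
  shows "p \<notin> S" and "q < p \<Longrightarrow> q \<in> S"
  using assms unfolding outer_corners_def by auto

lemma outer_corners_antichain:
  "p \<in> outer_corners S \<Longrightarrow> q \<in> outer_corners S \<Longrightarrow> p \<le> q \<Longrightarrow> p = q"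
  unfolding outer_corners_def by (auto simp: order.order_iff_strict)

lemma exists_outer_corner_le:
  fixes p :: point
  assumes "p \<notin> S"
  obtains c where "c \<in> outer_corners S" "c \<le> p"
proof -
  let ?B = "{q. q \<le> p \<and> q \<notin> S}"
  have "?B \<subseteq> {..fst p} \<times> {..snd p}"
    by (auto simp: less_eq_prod_def)
  then have "finite ?B"
    using finite_subset by blast
  then obtain c where c: "c \<in> ?B" and min: "\<forall>q\<in>?B. q \<le> c \<longrightarrow> c = q"
    using finite_has_minimal2[of ?B p] assms by auto
  have "q \<in> S" if "q < c" for q
  proof (rule ccontr)
    assume "q \<notin> S"
    moreover have "q \<le> p"
      using order_trans[OF less_imp_le[OF that]] c by simp
    ultimately have "c = q"
      using min less_imp_le[OF that] by blast
    then show False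
      using that by simp
  qed
  then have "c \<in> outer_corners S"
    unfolding outer_corners_def using c by simp
  then show ?thesis
    using c that by blast
qed

definition below_corner :: "point set \<Rightarrow> point set \<Rightarrow> point \<Rightarrow> point \<Rightarrow> bool" where
  "below_corner D E k c \<longleftrightarrow> k \<in> D \<and> c \<in> outer_corners E \<and> fst k < fst c \<and> snd k < snd c"

text \<open>For the arrows from \<open>x\<^sup>p\<^sup>+\<^sup>s\<close> to \<open>x\<^sup>p x\<^sub>3\<^sup>C\<close> with \<open>p\<close> in the top slice \<open>D\<close> and \<open>p + s\<close> outside
  the bottom slice \<open>E\<close>: translating such an arrow with \<open>p\<close> on the wall \<open>p\<^sub>1 = k\<^sub>1\<close> by \<open>-e\<^sub>1\<close>
  moves its tail into \<open>E\<close>.\<close>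
definition wall_blocked :: "point set \<Rightarrow> point set \<Rightarrow> point \<Rightarrow> point \<Rightarrow> bool" where
  "wall_blocked D E k s \<longleftrightarrow> (\<forall>y. (fst k, y) \<in> D \<longrightarrow> snd k \<le> y \<longrightarrow>
     (fst k + fst s, y + snd s) \<notin> E \<longrightarrow> (fst k + fst s - 1, y + snd s) \<in> E)"

text \<open>If the wall condition failed at some \<open>y > k\<^sub>2\<close>, an outer corner of \<open>E\<close> below
  \<open>(a - 1, y + 1)\<close> would lie strictly above a point of \<open>D\<close> with coordinate sum larger than
  \<open>k\<^sub>1 + k\<^sub>2\<close>.\<close>
lemma maximal_below_corner_wall_blocked:
  assumes D: "down_closed D" and E: "down_closed E"
    and diag: "\<forall>(x, y)\<in>D. (Suc x, Suc y) \<in> E"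
    and kc: "below_corner D E (k1, k2) (a, b)"
    and max: "\<forall>k c. below_corner D E k c \<longrightarrow> fst k + snd k \<le> k1 + k2"
  shows "wall_blocked D E (k1, k2) (a - k1, b - k2)"
  unfolding wall_blocked_def fst_conv snd_conv
proof (intro allI impI)
  fix y
  assume y: "(k1, y) \<in> D" "k2 \<le> y" "(k1 + (a - k1), y + (b - k2)) \<notin> E"
  have ab: "(a, b) \<in> outer_corners E" "k1 < a" "k2 < b"
    using kc unfolding below_corner_def by auto
  show "(k1 + (a - k1) - 1, y + (b - k2)) \<in> E"
  proof (cases "y = k2")
    case True
    have "(a - 1, b) < (a, b)"
      using ab by (auto simp: less_le_not_le)
    then show ?thesis
      using True ab outer_cornersD(2)[OF ab(1)] by simp
  next
    case False
    have "(k1, Suc k2) \<in> D"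
      using down_closedD[OF D y(1)] False y(2) by simp
    then have b: "b = Suc k2"
      using max ab kc unfolding below_corner_def
      by (metis Suc_lessI add_Suc_right fst_conv not_less_eq_eq snd_conv)
    show ?thesis
    proof (rule ccontr)
      assume "(k1 + (a - k1) - 1, y + (b - k2)) \<notin> E"
      then have "(a - 1, Suc y) \<notin> E"
        using ab b by simp
      then obtain x0 y0 where c: "(x0, y0) \<in> outer_corners E" "(x0, y0) \<le> (a - 1, Suc y)"
        by (metis exists_outer_corner_le surj_pair)
      have "(a - 1, b) \<in> E"
        using ab outer_cornersD(2)[OF ab(1), of "(a - 1, b)"] by (auto simp: less_le_not_le)
      then have "b < y0"
        using c down_closedD[OF E, of "(a - 1, b)" "(x0, y0)"] outer_cornersD(1)[OF c(1)]
        by (metis Pair_le not_less)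
      then have "(k1, y0 - 1) \<in> D"
        using c(2) down_closedD[OF D y(1), of "(k1, y0 - 1)"] by auto
      moreover have "Suc k1 < x0"
      proof (rule ccontr)
        assume "\<not> Suc k1 < x0"
        then have "(x0, y0) \<le> (Suc k1, Suc (y0 - 1))"
          using \<open>b < y0\<close> by simp
        then show False
          using diag \<open>(k1, y0 - 1) \<in> D\<close> down_closedD[OF E] outer_cornersD(1)[OF c(1)] by blast
      qed
      ultimately have "below_corner D E (k1, y0 - 1) (x0, y0)"
        using c(1) \<open>b < y0\<close> unfolding below_corner_def by simp
      then show False
        using max \<open>b < y0\<close> b by fastforce
    qed
  qed
qed

lemma down_closed_swap: "down_closed S \<Longrightarrow> down_closed (prod.swap ` (S :: point set))"
  unfolding down_closed_def by (auto simp: less_eq_prod_def)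

lemma swap_mem_outer_corners_swap:
  "prod.swap c \<in> outer_corners (prod.swap ` S) \<longleftrightarrow> c \<in> outer_corners (S :: point set)"
proof (cases c)
  case (Pair c1 c2)
  have "(\<forall>q<(c2, c1). q \<in> prod.swap ` S) \<longleftrightarrow> (\<forall>q<(c1, c2). q \<in> S)"
    by (auto simp: less_le_not_le)
  then show ?thesis
    using Pair unfolding outer_corners_def by simp
qed

lemma below_corner_swap:
  "below_corner (prod.swap ` D) (prod.swap ` E) (prod.swap k) (prod.swap c) \<longleftrightarrow> below_corner D E k c"
  unfolding below_corner_def swap_mem_outer_corners_swap by (cases k) auto

text \<open>If some \<open>p \<in> D\<close> has \<open>p + (1, 1) \<notin> E\<close>, the shift \<open>(1, 1)\<close> from the origin works
  because of the axis conditions. Otherwise shift a point \<open>k \<in> D\<close> lying strictly below an outer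
  corner \<open>c\<close> of \<open>E\<close> onto \<open>c\<close>, with \<open>k\<^sub>1 + k\<^sub>2\<close> maximal; the second wall condition is the
  first one for the mirrored sets.\<close>
lemma exists_blocked_shift:
  assumes D: "down_closed D" and E: "down_closed E" and "finite D" "(0, 0) \<in> D"
    and corner: "(a, b) \<in> outer_corners E" "0 < a" "0 < b"
    and axis_x: "\<forall>x. (x, 0) \<in> D \<longrightarrow> (Suc x, 0) \<in> E"
    and axis_y: "\<forall>y. (0, y) \<in> D \<longrightarrow> (0, Suc y) \<in> E"
  obtains k1 k2 s1 s2 u1 u2 where "0 < s1" "0 < s2" "(u1, u2) \<in> D" "k1 \<le> u1" "k2 \<le> u2"
    "(u1 + s1, u2 + s2) \<notin> E" "wall_blocked D E (k1, k2) (s1, s2)"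
    "wall_blocked (prod.swap ` D) (prod.swap ` E) (k2, k1) (s2, s1)"
proof (cases "\<forall>(x, y)\<in>D. (Suc x, Suc y) \<in> E")
  case False
  then obtain x y where "(x, y) \<in> D" "(Suc x, Suc y) \<notin> E"
    by auto
  then show ?thesis
    using that[of 1 1 x y 0 0] axis_x axis_y by (simp add: wall_blocked_def)
next
  case diag: True
  let ?P = "\<lambda>k. \<exists>c. below_corner D E k c"
  obtain B where "\<forall>n\<in>(\<lambda>k. fst k + snd k) ` D. n < B"
    using finite_nat_set_iff_bounded \<open>finite D\<close> by blast
  then have bound: "\<forall>k. ?P k \<longrightarrow> fst k + snd k < B"
    unfolding below_corner_def by auto
  have "?P (0, 0)"
    using corner \<open>(0, 0) \<in> D\<close> unfolding below_corner_def by auto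
  then obtain k where "?P k" and max: "\<forall>k'. ?P k' \<longrightarrow> fst k' + snd k' \<le> fst k + snd k"
    using ex_has_greatest_nat[OF _ bound] by blast
  then obtain k1 k2 a' b' where k: "k = (k1, k2)" and kc: "below_corner D E (k1, k2) (a', b')"
    by (metis surj_pair)
  have max12: "\<forall>k c. below_corner D E k c \<longrightarrow> fst k + snd k \<le> k1 + k2"
    using max k by auto
  have "wall_blocked D E (k1, k2) (a' - k1, b' - k2)"
    using maximal_below_corner_wall_blocked[OF D E diag kc max12] .
  moreover have "wall_blocked (prod.swap ` D) (prod.swap ` E) (k2, k1) (b' - k2, a' - k1)"
  proof (rule maximal_below_corner_wall_blocked)
    show "below_corner (prod.swap ` D) (prod.swap ` E) (k2, k1) (b', a')"
      using kc below_corner_swap[of D E "(k1, k2)" "(a', b')"] by simp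
    show "\<forall>k c. below_corner (prod.swap ` D) (prod.swap ` E) k c \<longrightarrow> fst k + snd k \<le> k2 + k1"
      using max12 below_corner_swap[of D E "prod.swap _" "prod.swap _"]
      by (metis add.commute snd_swap swap_swap)
  qed (use D E diag down_closed_swap in auto)
  moreover have "(k1, k2) \<in> D" "k1 < a'" "k2 < b'" "(a', b') \<notin> E"
    using kc outer_cornersD(1) unfolding below_corner_def by auto
  ultimately show ?thesis
    using that[of "a' - k1" "b' - k2" k1 k2 k1 k2] by simp
qed

section \<open>Minimal generators and slices of a basis set\<close>

lemma min_gens_eq_outer_corners: "min_gens \<beta> = outer_corners \<beta>"
  unfolding min_gens_def outer_corners_def by (auto simp: less_le)

lemma basis_set_down_closed: "basis_set \<beta> \<Longrightarrow> down_closed \<beta>"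
  unfolding basis_set_def down_closed_def by blast

lemma min_gens_decrement:
  assumes "m \<in> min_gens \<beta>" "1 \<le> m l"
  shows "m(l := m l - 1) \<in> \<beta>"
proof -
  have "m(l := m l - 1) < m"
    using assms(2) by (auto simp: less_fun_def le_fun_def intro!: exI[of _ l])
  then show ?thesis
    using assms(1) outer_cornersD(2) unfolding min_gens_eq_outer_corners by blast
qed

lemma min_gens_on_axis_unique:
  assumes "m \<in> min_gens \<beta>" "m' \<in> min_gens \<beta>"
    and "\<forall>l. l \<noteq> j \<longrightarrow> m l = 0" "\<forall>l. l \<noteq> j \<longrightarrow> m' l = 0"
  shows "m = m'"
proof -
  have "m \<le> m' \<or> m' \<le> m"
    unfolding le_fun_def using assms(3,4) by (metis le0 nle_le)
  then show ?thesis
    using assms(1,2) outer_corners_antichain unfolding min_gens_eq_outer_corners by metis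
qed

text \<open>Being an antichain, \<open>G \<beta> i j\<close> holds at most one pure power of \<open>x\<^sub>i\<close> and at most one
  of \<open>x\<^sub>j\<close>.\<close>
lemma interior_min_gen_exists:
  assumes "2 < card (G \<beta> i j)" "i \<noteq> j"
  shows "\<exists>m\<in>G \<beta> i j. 1 \<le> m i \<and> 1 \<le> m j"
proof (rule ccontr)
  assume "\<not> ?thesis"
  then have split: "G \<beta> i j = {m \<in> G \<beta> i j. m i = 0} \<union> {m \<in> G \<beta> i j. m j = 0}"
    by auto
  have axis_card: "card {m \<in> G \<beta> i j. m l = 0} \<le> 1" if l: "l = i \<or> l = j" for l
  proof -
    let ?A = "{m \<in> G \<beta> i j. m l = 0}"
    have vanish: "\<forall>l'. l' \<noteq> (if l = i then j else i) \<longrightarrow> m l' = 0" if "m \<in> ?A" for m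
    proof (intro allI impI)
      fix l' assume "l' \<noteq> (if l = i then j else i)"
      then show "m l' = 0"
        using that l assms(2) unfolding G_def by (cases "l' = l") auto
    qed
    have "\<forall>m\<in>?A. \<forall>m'\<in>?A. m = m'"
    proof (intro ballI)
      fix m m' assume m: "m \<in> ?A" and m': "m' \<in> ?A"
      show "m = m'"
        using min_gens_on_axis_unique[OF _ _ vanish[OF m] vanish[OF m']] m m' unfolding G_def by blast
    qed
    then show ?thesis
      using card_le_Suc0_iff_eq[of ?A] by (cases "finite ?A") simp_all
  qed
  then have "card (G \<beta> i j) \<le> 2"
    using arg_cong[OF split, of card]
      card_Un_le[of "{m \<in> G \<beta> i j. m i = 0}" "{m \<in> G \<beta> i j. m j = 0}"] axis_card[OF disjI1[OF refl]] axis_card[OF disjI2[OF refl]] by linarith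
  then show False
    using assms(1) by simp
qed

lemma axis_power_mem_of_min_gen:
  assumes "basis_set \<beta>" "h \<in> G \<beta> i k" "i \<noteq> k" "1 \<le> h k" "m \<in> \<beta>" "h k \<le> m k"
  shows "(\<lambda>l. if l = i then Suc (m i) else 0) \<in> \<beta>"
proof (rule ccontr)
  assume out: "(\<lambda>l. if l = i then Suc (m i) else 0) \<notin> \<beta>"
  have down: "down_closed \<beta>"
    using assms(1) by (rule basis_set_down_closed)
  have h: "h \<in> min_gens \<beta>" "\<forall>l. l \<noteq> i \<and> l \<noteq> k \<longrightarrow> h l = 0"
    using assms(2) unfolding G_def by auto
  have "(\<lambda>l. if l = i then h i else 0) \<le> h(k := h k - 1)"
    using assms(3) by (auto simp: le_fun_def)
  then have pure: "(\<lambda>l. if l = i then h i else 0) \<in> \<beta>"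
    using down_closedD[OF down min_gens_decrement[OF h(1) assms(4)]] by blast
  have "h i \<le> m i"
  proof (rule ccontr)
    assume "\<not> h i \<le> m i"
    then have "(\<lambda>l. if l = i then Suc (m i) else 0) \<le> (\<lambda>l. if l = i then h i else 0)"
      by (auto simp: le_fun_def)
    then show False
      using out down_closedD[OF down pure] by blast
  qed
  then have "h \<le> m"
    using h(2) assms(6) by (auto simp: le_fun_def)
  then show False
    using down_closedD[OF down assms(5)] h(1) outer_cornersD(1)
    unfolding min_gens_eq_outer_corners by blast
qed

lemma index_3_cases:
  fixes i :: 3
  shows "i = 0 \<or> i = 1 \<or> i = 2"
proof (induct i)
  case (of_int z)
  then have "z = 0 \<or> z = 1 \<or> z = 2" by fastforce
  then show ?case by auto
qed

text \<open>Coordinates \<open>0, 1, 2\<close> of the index type \<open>3\<close> stand for \<open>x\<^sub>1, x\<^sub>2, x\<^sub>3\<close>.\<close>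
definition mon3 :: "nat \<Rightarrow> nat \<Rightarrow> nat \<Rightarrow> mon" where
  "mon3 x y z = (\<lambda>i. if i = 0 then x else if i = 1 then y else z)"

lemma mon3_apply [simp]: "mon3 x y z 0 = x" "mon3 x y z 1 = y" "mon3 x y z 2 = z"
  unfolding mon3_def by simp_all

lemma mon3_eta: "mon3 (m 0) (m 1) (m 2) = m"
  using index_3_cases by (auto simp: mon3_def fun_eq_iff)

lemma mon3_le_iff [simp]: "mon3 x y z \<le> mon3 x' y' z' \<longleftrightarrow> x \<le> x' \<and> y \<le> y' \<and> z \<le> z'"
proof
  assume "mon3 x y z \<le> mon3 x' y' z'"
  then show "x \<le> x' \<and> y \<le> y' \<and> z \<le> z'"
    by (metis le_fun_def mon3_apply)
next
  assume "x \<le> x' \<and> y \<le> y' \<and> z \<le> z'"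
  then show "mon3 x y z \<le> mon3 x' y' z'"
    by (simp add: le_fun_def mon3_def)
qed

lemma mon3_upd [simp]:
  "(mon3 x y z)(0 := v) = mon3 v y z"
  "(mon3 x y z)(1 := v) = mon3 x v z"
  "(mon3 x y z)(2 := v) = mon3 x y v"
  using index_3_cases by (auto simp: mon3_def fun_eq_iff)

definition layer :: "mon set \<Rightarrow> nat \<Rightarrow> point set" where
  "layer \<beta> z = {(x, y). mon3 x y z \<in> \<beta>}"

lemma mem_layer [simp]: "(x, y) \<in> layer \<beta> z \<longleftrightarrow> mon3 x y z \<in> \<beta>"
  unfolding layer_def by simp

lemma down_closed_layer: "down_closed \<beta> \<Longrightarrow> down_closed (layer \<beta> z)"
  unfolding down_closed_def layer_def by (auto simp: less_eq_prod_def)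

lemma finite_layer: "finite \<beta> \<Longrightarrow> finite (layer \<beta> z)"
proof -
  have "layer \<beta> z \<subseteq> (\<lambda>m. (m 0, m 1)) ` \<beta>"
    unfolding layer_def by (auto intro: image_eqI[where x = "mon3 _ _ z"])
  then show "finite \<beta> \<Longrightarrow> finite (layer \<beta> z)"
    using finite_surj by blast
qed

definition x3_height :: "mon set \<Rightarrow> nat" where
  "x3_height \<beta> = Max {z. mon3 0 0 z \<in> \<beta>}"

lemma
  assumes "basis_set \<beta>"
  shows x3_height_ge: "m \<in> \<beta> \<Longrightarrow> m 2 \<le> x3_height \<beta>"
    and x3_height_mem: "mon3 0 0 (x3_height \<beta>) \<in> \<beta>"
proof -
  let ?Z = "{z. mon3 0 0 z \<in> \<beta>}"
  have down: "down_closed \<beta>" and fin: "finite \<beta>" and ne: "\<beta> \<noteq> {}"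
    using assms basis_set_down_closed unfolding basis_set_def by auto
  have axis: "m 2 \<in> ?Z" if "m \<in> \<beta>" for m
    using down_closedD[OF down that, of "mon3 0 0 (m 2)"] mon3_le_iff[of 0 0 "m 2"] mon3_eta[of m]
    by (metis le0 le_refl mem_Collect_eq)
  have "?Z \<subseteq> (\<lambda>m. m 2) ` \<beta>"
    by (auto intro: image_eqI[where x = "mon3 0 0 _"])
  then have "finite ?Z"
    using fin finite_surj by blast
  moreover have "?Z \<noteq> {}"
    using ne axis by blast
  ultimately show "m \<in> \<beta> \<Longrightarrow> m 2 \<le> x3_height \<beta>" and "mon3 0 0 (x3_height \<beta>) \<in> \<beta>"
    using axis Max_in unfolding x3_height_def by auto
qed

lemma G01_outer_corner:
  assumes "g \<in> G \<beta> 0 1"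
  shows "(g 0, g 1) \<in> outer_corners (layer \<beta> 0)"
proof -
  have g: "g = mon3 (g 0) (g 1) 0" "g \<in> outer_corners \<beta>"
    using assms mon3_eta[of g] unfolding G_def min_gens_eq_outer_corners by auto
  have "(a, b) \<in> layer \<beta> 0" if "(a, b) < (g 0, g 1)" for a b
  proof -
    have "mon3 a b 0 < mon3 (g 0) (g 1) 0"
      using that by (auto simp: less_le_not_le)
    then show ?thesis
      using outer_cornersD(2)[OF g(2)] g(1) by simp
  qed
  moreover have "(g 0, g 1) \<notin> layer \<beta> 0"
    using outer_cornersD(1)[OF g(2)] g(1) by simp
  ultimately show ?thesis
    unfolding outer_corners_def by auto
qed

lemma top_layer_axes_shorter:
  assumes "basis_set \<beta>"
    and h: "h \<in> G \<beta> 0 2" "1 \<le> h 0" "1 \<le> h 2"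
    and w: "w \<in> G \<beta> 1 2" "1 \<le> w 1" "1 \<le> w 2"
  shows "\<forall>x. (x, 0) \<in> layer \<beta> (x3_height \<beta>) \<longrightarrow> (Suc x, 0) \<in> layer \<beta> 0"
    and "\<forall>y. (0, y) \<in> layer \<beta> (x3_height \<beta>) \<longrightarrow> (0, Suc y) \<in> layer \<beta> 0"
proof -
  have "(h(0 := h 0 - 1)) 2 \<le> x3_height \<beta>" "(w(1 := w 1 - 1)) 2 \<le> x3_height \<beta>"
    using h w min_gens_decrement x3_height_ge[OF assms(1)] unfolding G_def by blast+
  then have hw: "h 2 \<le> x3_height \<beta>" "w 2 \<le> x3_height \<beta>"
    by simp_all
  have "(\<lambda>l. if l = 0 then Suc x else 0) = mon3 (Suc x) 0 0"
    and "(\<lambda>l. if l = 1 then Suc y else 0) = mon3 0 (Suc y) 0" for x y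
    by (auto simp: mon3_def fun_eq_iff)
  then show "\<forall>x. (x, 0) \<in> layer \<beta> (x3_height \<beta>) \<longrightarrow> (Suc x, 0) \<in> layer \<beta> 0"
    and "\<forall>y. (0, y) \<in> layer \<beta> (x3_height \<beta>) \<longrightarrow> (0, Suc y) \<in> layer \<beta> 0"
    using axis_power_mem_of_min_gen[OF assms(1) h(1) _ h(3), of "mon3 _ 0 (x3_height \<beta>)"]
      axis_power_mem_of_min_gen[OF assms(1) w(1) _ w(3), of "mon3 0 _ (x3_height \<beta>)"] hw
    by simp_all
qed

section \<open>Arrows trapped between the slices\<close>

lemma translation_step_sym:
  assumes "translation_step \<beta> (d, j) (d', j')"
  shows "translation_step \<beta> (d', j') (d, j)"
proof -
  obtain i where arrows: "is_arrow \<beta> (d, j)" "is_arrow \<beta> (d', j')"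
    and "(d' = d(i := d i + 1) \<and> j' = j(i := j i + 1))
      \<or> (1 \<le> d i \<and> 1 \<le> j i \<and> d' = d(i := d i - 1) \<and> j' = j(i := j i - 1))"
    using assms unfolding translation_step_def by auto
  then have "(d = d'(i := d' i + 1) \<and> j = j'(i := j' i + 1))
      \<or> (1 \<le> d' i \<and> 1 \<le> j' i \<and> d = d'(i := d' i - 1) \<and> j = j'(i := j' i - 1))"
    by (elim disjE conjE) simp_all
  then show ?thesis
    unfolding translation_step_def using arrows by auto
qed

lemma translation_equiv_eq: "translation_equiv \<beta> = (translation_step \<beta>)\<^sup>*\<^sup>*"
proof -
  have "(\<lambda>c c'. translation_step \<beta> c c' \<or> translation_step \<beta> c' c) = translation_step \<beta>"
    using translation_step_sym by (intro ext) (metis surj_pair)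
  then show ?thesis
    unfolding translation_equiv_def by simp
qed

lemma translation_step_mon3_cases:
  assumes "translation_step \<beta> (mon3 a b c, mon3 a' b' c') q"
  obtains "q = (mon3 (Suc a) b c, mon3 (Suc a') b' c')"
  | "0 < a" "0 < a'" "q = (mon3 (a - 1) b c, mon3 (a' - 1) b' c')"
  | "q = (mon3 a (Suc b) c, mon3 a' (Suc b') c')"
  | "0 < b" "0 < b'" "q = (mon3 a (b - 1) c, mon3 a' (b' - 1) c')"
  | "q = (mon3 a b (Suc c), mon3 a' b' (Suc c'))"
  | "0 < c" "0 < c'" "q = (mon3 a b (c - 1), mon3 a' b' (c' - 1))"
proof -
  let ?d = "mon3 a b c" and ?j = "mon3 a' b' c'"
  obtain i where "q = (?d(i := ?d i + 1), ?j(i := ?j i + 1))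
      \<or> (1 \<le> ?d i \<and> 1 \<le> ?j i \<and> q = (?d(i := ?d i - 1), ?j(i := ?j i - 1)))"
    using assms unfolding translation_step_def by auto
  moreover have "i = 0 \<or> i = 1 \<or> i = 2"
    by (rule index_3_cases)
  ultimately show thesis
    by (elim disjE conjE) (simp_all add: that)
qed

lemma nonstandard_mon3_arrow:
  assumes "0 < s1" "0 < s2"
  shows "\<not> standard_arrow (mon3 (x + s1) (y + s2) 0, mon3 x y z)"
proof -
  have "i \<in> {i. mon3 x y z i < mon3 (x + s1) (y + s2) 0 i} \<longleftrightarrow> i \<in> {0, 1}" for i
    using assms index_3_cases[of i] by auto
  then have "{i. mon3 x y z i < mon3 (x + s1) (y + s2) 0 i} = {0, 1}"
    by blast
  then show ?thesis
    unfolding standard_arrow_def by simp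
qed

context
  fixes \<beta> :: "mon set" and C k1 k2 s1 s2 :: nat
  assumes above_top: "\<forall>x y. mon3 x y (Suc C) \<notin> \<beta>"
    and x_wall: "wall_blocked (layer \<beta> C) (layer \<beta> 0) (k1, k2) (s1, s2)"
    and y_wall: "wall_blocked (prod.swap ` layer \<beta> C) (prod.swap ` layer \<beta> 0) (k2, k1) (s2, s1)"
begin

definition trapped_arrows :: "arrow set" where
  "trapped_arrows = {(mon3 (x + s1) (y + s2) 0, mon3 x y C) | x y.
     k1 \<le> x \<and> k2 \<le> y \<and> mon3 x y C \<in> \<beta> \<and> mon3 (x + s1) (y + s2) 0 \<notin> \<beta>}"

lemma trapped_arrowsI:
  "k1 \<le> x \<Longrightarrow> k2 \<le> y \<Longrightarrow> mon3 x y C \<in> \<beta> \<Longrightarrow> mon3 (x + s1) (y + s2) 0 \<notin> \<beta> \<Longrightarrow>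
    (mon3 (x + s1) (y + s2) 0, mon3 x y C) \<in> trapped_arrows"
  unfolding trapped_arrows_def by blast

lemma x_wallD:
  "mon3 k1 y C \<in> \<beta> \<Longrightarrow> k2 \<le> y \<Longrightarrow> mon3 (k1 + s1) (y + s2) 0 \<notin> \<beta> \<Longrightarrow>
    mon3 (k1 + s1 - 1) (y + s2) 0 \<in> \<beta>"
  using x_wall unfolding wall_blocked_def by simp

lemma y_wallD:
  "mon3 x k2 C \<in> \<beta> \<Longrightarrow> k1 \<le> x \<Longrightarrow> mon3 (x + s1) (k2 + s2) 0 \<notin> \<beta> \<Longrightarrow>
    mon3 (x + s1) (k2 + s2 - 1) 0 \<in> \<beta>"
  using y_wall unfolding wall_blocked_def by simp

lemma trapped_arrows_step:
  assumes "c \<in> trapped_arrows" "translation_step \<beta> c c'"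
  shows "c' \<in> trapped_arrows"
proof -
  obtain x y where xy: "k1 \<le> x" "k2 \<le> y" "mon3 x y C \<in> \<beta>" "mon3 (x + s1) (y + s2) 0 \<notin> \<beta>"
    and c: "c = (mon3 (x + s1) (y + s2) 0, mon3 x y C)"
    using assms(1) unfolding trapped_arrows_def by blast
  have c': "fst c' \<notin> \<beta>" "snd c' \<in> \<beta>"
    using assms(2) unfolding translation_step_def is_arrow_def by auto
  from assms(2)[unfolded c] show ?thesis
  proof (cases rule: translation_step_mon3_cases)
    case 1
    then show ?thesis
      using trapped_arrowsI[of "Suc x" y] xy c' by simp
  next
    case 2
    moreover have "x \<noteq> k1"
      using 2 c' x_wallD xy(2-4) by auto
    ultimately show ?thesis
      using trapped_arrowsI[of "x - 1" y] xy c' by simp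
  next
    case 3
    then show ?thesis
      using trapped_arrowsI[of x "Suc y"] xy c' by simp
  next
    case 4
    moreover have "y \<noteq> k2"
      using 4 c' y_wallD xy(1,3,4) by auto
    ultimately show ?thesis
      using trapped_arrowsI[of x "y - 1"] xy c' by simp
  next
    case 5
    then show ?thesis
      using c' above_top by simp
  qed simp
qed

lemma trapped_arrow_not_zero:
  assumes "c \<in> trapped_arrows"
  shows "\<not> trans_equiv_zero \<beta> c"
proof
  assume "trans_equiv_zero \<beta> c"
  then obtain d j i where "translation_equiv \<beta> c (d, j)"
    and zero: "j i = 0" "1 \<le> d i" "d(i := d i - 1) \<notin> \<beta>"
    unfolding trans_equiv_zero_def by blast
  then have "(d, j) \<in> trapped_arrows"
    using assms trapped_arrows_step unfolding translation_equiv_eq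
    by (induction rule: rtranclp_induct) auto
  then obtain x y where xy: "k1 \<le> x" "k2 \<le> y" "mon3 x y C \<in> \<beta>" "mon3 (x + s1) (y + s2) 0 \<notin> \<beta>"
    and dj: "d = mon3 (x + s1) (y + s2) 0" "j = mon3 x y C"
    unfolding trapped_arrows_def by blast
  consider "i = 0" | "i = 1" | "i = 2"
    using index_3_cases by blast
  then show False
  proof cases
    case 1
    then have "x = k1"
      using zero(1) dj xy(1) by simp
    then have "mon3 (x + s1 - 1) (y + s2) 0 \<in> \<beta>"
      using x_wallD xy(2-4) by simp
    then show False
      using zero(3) dj 1 by simp
  next
    case 2
    then have "y = k2"
      using zero(1) dj xy(2) by simp
    then have "mon3 (x + s1) (y + s2 - 1) 0 \<in> \<beta>"
      using y_wallD xy(1,3,4) by simp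
    then show False
      using zero(3) dj 2 by simp
  next
    case 3
    then show False
      using zero dj by simp
  qed
qed

lemma trapped_arrow_witness:
  assumes "0 < s1" "0 < s2" "(u1, u2) \<in> layer \<beta> C" "k1 \<le> u1" "k2 \<le> u2"
    and "(u1 + s1, u2 + s2) \<notin> layer \<beta> 0"
  shows "\<exists>c. is_arrow \<beta> c \<and> \<not> standard_arrow c \<and> \<not> trans_equiv_zero \<beta> c"
proof -
  let ?c = "(mon3 (u1 + s1) (u2 + s2) 0, mon3 u1 u2 C)"
  have "?c \<in> trapped_arrows"
    using assms unfolding trapped_arrows_def by auto
  then show ?thesis
    using trapped_arrow_not_zero nonstandard_mon3_arrow[OF assms(1,2)] assms(3,6)
    by (intro exI[of _ ?c]) (simp add: is_arrow_def)
qed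

end

theorem lemma10p1:
  fixes \<beta> :: "mon set"
  assumes "basis_set \<beta>"
    and "\<forall>i j. i \<noteq> j \<longrightarrow> card (G \<beta> i j) > 2"
  shows "\<exists>c. is_arrow \<beta> c \<and> \<not> standard_arrow c \<and> \<not> trans_equiv_zero \<beta> c"
proof -
  have interior: "\<exists>m\<in>G \<beta> i j. 1 \<le> m i \<and> 1 \<le> m j" if "i \<noteq> j" for i j
    using interior_min_gen_exists assms(2) that by blast
  obtain g h w where g: "g \<in> G \<beta> 0 1" "1 \<le> g 0" "1 \<le> g 1"
    and h: "h \<in> G \<beta> 0 2" "1 \<le> h 0" "1 \<le> h 2"
    and w: "w \<in> G \<beta> 1 2" "1 \<le> w 1" "1 \<le> w 2"
    using interior[of 0 1] interior[of 0 2] interior[of 1 2] by auto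
  have down: "down_closed (layer \<beta> z)" and fin: "finite (layer \<beta> z)" for z
    using assms(1) basis_set_down_closed down_closed_layer finite_layer
    unfolding basis_set_def by auto
  have above_top: "\<forall>x y. mon3 x y (Suc (x3_height \<beta>)) \<notin> \<beta>"
    using x3_height_ge[OF assms(1)] by fastforce
  show ?thesis
  proof (rule exists_blocked_shift[OF down down fin _ G01_outer_corner[OF g(1)] _ _
        top_layer_axes_shorter[OF assms(1) h w]])
    show "(0, 0) \<in> layer \<beta> (x3_height \<beta>)"
      using x3_height_mem[OF assms(1)] by simp
  qed (use g trapped_arrow_witness[OF above_top] in auto)
qed

end
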